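(* In the setting and notation of the context, assume $\mathcal{P}>0$ and let $\epsilon,\eta>0$ be constants. Let $\gamma_S=\dfrac{d\,g}{c\,\beta+1}$ with cumulative distribution function $F_{\gamma_S}$, and define the symbol error probability of the secondary user by $$P_e=\frac{\epsilon\sqrt{\eta}}{2\sqrt{\pi}}\int_0^\infty F_{\gamma_S}(\gamma)\,\frac{\exp(-\eta\gamma)}{\sqrt{\gamma}}\,d\gamma .$$ Put $F_0=\dfrac{c\,\Omega_\beta}{d\,\Omega_g}$, $\dfrac1{G_0}=\dfrac{1}{d\,\Omega_g}$ and $\dfrac{1}{F_1}=\dfrac{1}{G_0}+\eta$. Then $$P_e=\frac{\epsilon}{2}-\frac{\epsilon}{2}\sqrt{\frac{\eta\pi}{F_0}}\,\exp\left(\frac{1}{F_0F_1}\right)\left[1-\mathcal{Q}\left(\frac{1}{\sqrt{F_0F_1}}\right)\right],$$ where $\mathcal{Q}(z)=\frac{2}{\sqrt{\pi}}\int_0^z e^{-t^2}\,dt$.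
   Context: $P_p,N_0,B,r_p,P_{\text{pk}}>0$ and $\theta_{th}\in(0,1)$ are constants (primary transmit power, noise power, bandwidth, primary target rate, secondary peak power, primary outage threshold). The channel power gains $g$ (secondary transmitter to secondary receiver) and $\beta$ (primary transmitter to secondary receiver) are independent exponential random variables with means $\Omega_g,\Omega_\beta>0$; $\Omega_h,\Omega_\alpha>0$ are the mean channel gains of the primary transmitter to primary receiver and secondary transmitter to primary receiver links. The secondary transmitter uses the deterministic power $$\mathcal{P}=\min\left\{\frac{P_p\Omega_h}{\gamma_{th}\Omega_\alpha}\chi^{+},P_{\text{pk}}\right\},\quad \gamma_{th}=2^{r_p/B}-1,\quad \chi^{+}=\max\left\{\frac{1}{1-\theta_{th}}\exp\left(-\frac{N_0\gamma_{th}}{P_p\Omega_h}\right)-1,0\right\}.$$ Set $c=P_p/N_0$ and $d=\mathcal{P}/N_0$. The random variable $\gamma_S$ is the signal-to-interference-plus-noise ratio at the secondary receiver. The constants $\epsilon,\eta$ depend on the modulation scheme. *)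

theory Defs
  imports "HOL-Probability.Probability"
begin

definition sinr_threshold :: "real \<Rightarrow> real \<Rightarrow> real" where
  "sinr_threshold r\<^sub>p B = 2 powr (r\<^sub>p / B) - 1"

definition chi_plus :: "real \<Rightarrow> real \<Rightarrow> real \<Rightarrow> real \<Rightarrow> real \<Rightarrow> real" where
  "chi_plus P\<^sub>p N\<^sub>0 \<gamma>\<^sub>t\<^sub>h \<theta>\<^sub>t\<^sub>h \<Omega>\<^sub>h =
     max (1 / (1 - \<theta>\<^sub>t\<^sub>h) * exp (- (N\<^sub>0 * \<gamma>\<^sub>t\<^sub>h / (P\<^sub>p * \<Omega>\<^sub>h))) - 1) 0"

definition secondary_power ::
  "real \<Rightarrow> real \<Rightarrow> real \<Rightarrow> real \<Rightarrow> real \<Rightarrow> real \<Rightarrow> real \<Rightarrow> real \<Rightarrow> real" where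
  "secondary_power P\<^sub>p N\<^sub>0 B r\<^sub>p P\<^sub>p\<^sub>k \<theta>\<^sub>t\<^sub>h \<Omega>\<^sub>h \<Omega>\<^sub>\<alpha> =
     (let \<gamma>\<^sub>t\<^sub>h = sinr_threshold r\<^sub>p B
      in min (P\<^sub>p * \<Omega>\<^sub>h / (\<gamma>\<^sub>t\<^sub>h * \<Omega>\<^sub>\<alpha>) * chi_plus P\<^sub>p N\<^sub>0 \<gamma>\<^sub>t\<^sub>h \<theta>\<^sub>t\<^sub>h \<Omega>\<^sub>h) P\<^sub>p\<^sub>k)"

definition secondary_sinr ::
  "real \<Rightarrow> real \<Rightarrow> ('a \<Rightarrow> real) \<Rightarrow> ('a \<Rightarrow> real) \<Rightarrow> 'a \<Rightarrow> real" where
  "secondary_sinr c d g \<beta> = (\<lambda>\<omega>. d * g \<omega> / (c * \<beta> \<omega> + 1))"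

definition symbol_error_prob :: "real \<Rightarrow> real \<Rightarrow> (real \<Rightarrow> real) \<Rightarrow> real" where
  "symbol_error_prob \<epsilon> \<eta> F =
     \<epsilon> * sqrt \<eta> / (2 * sqrt pi) *
       (LBINT \<gamma>:{0<..}. F \<gamma> * (exp (- (\<eta> * \<gamma>)) / sqrt \<gamma>))"

(* This is the error function, not the Gaussian tail function often written Q. *)
definition Q_fun :: "real \<Rightarrow> real" where
  "Q_fun z = 2 / sqrt pi * (LBINT t=0..z. exp (- t\<^sup>2))"

end

theory Submission
  imports Defs
begin

text \<open>
  Conditioning on \<open>\<beta>\<close>, the exponential tail of \<open>g\<close> gives
  \<open>P (\<gamma>\<^sub>S > x) = exp (- x / G\<^sub>0) / (1 + F\<^sub>0 x)\<close>. Writing \<open>1 / (1 + F\<^sub>0 x)\<close> as the integral of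
  \<open>exp (- s (1 + F\<^sub>0 x))\<close> over \<open>s \<ge> 0\<close> and exchanging the order of integration, the \<open>x\<close>-integral
  becomes \<open>Gamma (1/2)\<close> up to scaling, and the remaining \<open>s\<close>-integral has the antiderivative
  \<open>s \<mapsto> exp b sqrt pi Q (sqrt (s + b))\<close> with \<open>b = 1 / (F\<^sub>0 F\<^sub>1)\<close>, up to a constant factor.
\<close>

section \<open>The error function: derivative and limit at infinity\<close>

lemma DERIV_Q_fun: "DERIV Q_fun z :> 2 / sqrt pi * exp (- z\<^sup>2)"
proof -
  \<comment> \<open>The interval is chosen to contain the base point 0 as well as a neighbourhood of
    z, whatever the sign of z, so that the one-sided notion reduces to \<open>at z\<close>.\<close>
  have "((\<lambda>u. LBINT y=ereal 0..u. exp (- y\<^sup>2)) has_vector_derivative exp (- z\<^sup>2))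
      (at z within {min 0 (z - 1)..max 0 (z + 1)})"
    by (rule interval_integral_FTC2) (auto intro!: continuous_intros)
  moreover have "at z within {min 0 (z - 1)..max 0 (z + 1)} = at z"
    by (rule at_within_interior) auto
  ultimately have "DERIV (\<lambda>u. LBINT y=0..u. exp (- y\<^sup>2)) z :> exp (- z\<^sup>2)"
    by (simp add: has_real_derivative_iff_has_vector_derivative zero_ereal_def)
  from DERIV_cmult[OF this, of "2 / sqrt pi"] show ?thesis
    by (simp add: Q_fun_def[abs_def])
qed

text \<open>The factor \<open>2 / sqrt pi\<close> normalises the half-line Gaussian integral, which
  \<open>gaussian_moment_0\<close> evaluates to \<open>sqrt pi / 2\<close>.\<close>

lemma tendsto_Q_fun_at_top: "(Q_fun \<longlongrightarrow> 1) at_top"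
proof -
  let ?f = "\<lambda>x::real. indicator {0..} x *\<^sub>R exp (- x\<^sup>2)"
  have "((\<lambda>z. \<integral>x. indicator {..z} x *\<^sub>R ?f x \<partial>lborel) \<longlongrightarrow> sqrt pi / 2) at_top"
    using tendsto_integral_at_top[of lborel ?f] gaussian_moment_0
    unfolding has_bochner_integral_iff by (simp del: real_scaleR_def)
  then have "((\<lambda>z. 2 / sqrt pi * (\<integral>x. indicator {..z} x *\<^sub>R ?f x \<partial>lborel))
      \<longlongrightarrow> 2 / sqrt pi * (sqrt pi / 2)) at_top"
    by (rule tendsto_mult_left)
  \<comment> \<open>For z < 0 the truncated integral is 0 while \<open>Q_fun z\<close> is negative,
    so the identity is claimed only from 0 on, which suffices for the limit.\<close>
  moreover have "eventually (\<lambda>z. 2 / sqrt pi * (\<integral>x. indicator {..z} x *\<^sub>R ?f x \<partial>lborel) = Q_fun z) at_top"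
    using eventually_ge_at_top[of 0]
  proof eventually_elim
    case (elim z)
    have "(\<integral>x. indicator {..z} x *\<^sub>R ?f x \<partial>lborel) = (LBINT x:{0..z}. exp (- x\<^sup>2))"
      unfolding set_lebesgue_integral_def
      by (rule Bochner_Integration.integral_cong) (auto simp: indicator_def)
    then show ?case
      using elim interval_integral_Icc[of 0 z "\<lambda>t. exp (- t\<^sup>2)"]
      by (simp add: Q_fun_def zero_ereal_def)
  qed
  ultimately show ?thesis
    by (simp add: tendsto_cong)
qed

section \<open>Exponential integrals with square-root denominators\<close>

text \<open>The substitution u = \<open>sqrt (s + b)\<close> makes the integrand Gaussian: the
  antiderivative \<open>?F\<close> tends to \<open>exp b * sqrt pi\<close> and starts at
  \<open>?F 0\<close>.\<close>

lemma nn_integral_exp_over_sqrt_shift: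
  fixes b :: real
  assumes b: "b > 0"
  shows "(\<integral>\<^sup>+s. ennreal (exp (- s) / sqrt (s + b)) * indicator {0..} s \<partial>lborel)
    = ennreal (exp b * sqrt pi * (1 - Q_fun (sqrt b)))"
proof -
  let ?F = "\<lambda>s. exp b * sqrt pi * Q_fun (sqrt (s + b))"
  have "(\<integral>\<^sup>+s. ennreal (exp (- s) / sqrt (s + b)) * indicator {0..} s \<partial>lborel)
      = exp b * sqrt pi * 1 - ?F 0"
  proof (rule nn_integral_FTC_atLeast)
    fix s :: real assume "0 \<le> s"
    then have "s + b > 0" using b by simp
    have "DERIV ?F s :> exp b * sqrt pi *
        (2 / sqrt pi * exp (- (sqrt (s + b))\<^sup>2) * (inverse (sqrt (s + b)) / 2))"
      using \<open>s + b > 0\<close>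
      by (auto intro!: derivative_eq_intros DERIV_chain2[OF DERIV_Q_fun])
    also have "exp b * sqrt pi *
        (2 / sqrt pi * exp (- (sqrt (s + b))\<^sup>2) * (inverse (sqrt (s + b)) / 2))
        = exp (- s) / sqrt (s + b)"
      using \<open>s + b > 0\<close> by (simp add: field_simps exp_add[symmetric] exp_diff exp_minus)
    finally show "DERIV ?F s :> exp (- s) / sqrt (s + b)" .
  next
    have "filterlim (\<lambda>s. sqrt (s + b)) at_top at_top"
      by real_asymp
    from filterlim_compose[OF tendsto_Q_fun_at_top this]
    show "(?F \<longlongrightarrow> exp b * sqrt pi * 1) at_top"
      by (rule tendsto_mult_left)
  qed (use b in auto)
  then show ?thesis by (simp add: algebra_simps)
qed

text \<open>Rescaling x by \<open>1 / a\<close> produces the Gamma integral at 1/2, whose value is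
  \<open>sqrt pi\<close>.\<close>

lemma nn_integral_exp_over_sqrt:
  fixes a :: real
  assumes a: "a > 0"
  shows "(\<integral>\<^sup>+x. ennreal (exp (- (a * x)) / sqrt x) * indicator {0<..} x \<partial>lborel) = ennreal (sqrt (pi / a))"
proof -
  let ?f = "\<lambda>x::real. ennreal (exp (- (a * x)) / sqrt x) * indicator {0<..} x"
  have "(\<integral>\<^sup>+x. ?f x \<partial>lborel) = ennreal \<bar>1 / a\<bar> * (\<integral>\<^sup>+x. ?f (0 + 1 / a * x) \<partial>lborel)"
    using a by (intro nn_integral_real_affine) auto
  also have "(\<integral>\<^sup>+x. ?f (0 + 1 / a * x) \<partial>lborel)
      = (\<integral>\<^sup>+x. ennreal (sqrt a) * ennreal (indicator {0..} x * x powr (1 / 2 - 1) / exp x) \<partial>lborel)"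
  proof (rule nn_integral_cong)
    fix x :: real
    \<comment> \<open>At x = 0 the two indicators differ, but the right side still vanishes there
      since 0 raised by \<open>powr\<close> is 0.\<close>
    show "?f (0 + 1 / a * x)
      = ennreal (sqrt a) * ennreal (indicator {0..} x * x powr (1 / 2 - 1) / exp x)"
      using a by (cases "x > 0")
        (auto simp: indicator_def zero_less_divide_iff powr_minus powr_half_sqrt exp_minus
          real_sqrt_divide field_simps ennreal_mult[symmetric])
  qed
  also have "\<dots> = ennreal (sqrt a) * ennreal (sqrt pi)"
    using Gamma_conv_nn_integral_real[of "1 / 2"]
    by (simp add: nn_integral_cmult Gamma_one_half_real)
  also have "ennreal \<bar>1 / a\<bar> * \<dots> = ennreal (sqrt (pi / a))"
    using a by (simp add: ennreal_mult[symmetric] real_sqrt_divide real_div_sqrt divide_simps)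
  finally show ?thesis .
qed

text \<open>With \<open>1 / (1 + k * x)\<close> written as an exponential integral in s, the inner
  x-integral has rate \<open>a + s * k\<close>; the outer one is then the shifted integral with
  \<open>b = a / k\<close>.\<close>

lemma nn_integral_exp_over_sqrt_linear:
  fixes a k :: real
  assumes a: "a > 0" and k: "k > 0"
  shows "(\<integral>\<^sup>+x. ennreal (exp (- (a * x)) / (sqrt x * (1 + k * x))) * indicator {0<..} x \<partial>lborel)
    = ennreal (pi / sqrt k * exp (a / k) * (1 - Q_fun (sqrt (a / k))))"
proof -
  let ?h = "\<lambda>x s :: real. ennreal (exp (- (a * x)) / sqrt x * exp (- s * (1 + k * x)))
      * indicator {0<..} x * indicator {0..} s"
  have exp_int: "(\<integral>\<^sup>+s. ennreal (exp (- s * w)) * indicator {0..} s \<partial>lborel) = ennreal (1 / w)"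
    if "w > 0" for w :: real
  proof -
    have "(\<integral>\<^sup>+s. ennreal (exp (- s * w)) * indicator {0..} s \<partial>lborel) = 0 - (- exp (- 0 * w) / w)"
    proof (rule nn_integral_FTC_atLeast)
      show "((\<lambda>s. - exp (- s * w) / w) \<longlongrightarrow> 0) at_top"
        using that by real_asymp
    qed (use that in \<open>auto intro!: derivative_eq_intros\<close>)
    then show ?thesis by simp
  qed
  have "(\<integral>\<^sup>+x. ennreal (exp (- (a * x)) / (sqrt x * (1 + k * x))) * indicator {0<..} x \<partial>lborel)
      = (\<integral>\<^sup>+x. (\<integral>\<^sup>+s. ?h x s \<partial>lborel) \<partial>lborel)"
  proof (rule nn_integral_cong)
    fix x :: real
    show "ennreal (exp (- (a * x)) / (sqrt x * (1 + k * x))) * indicator {0<..} x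
        = (\<integral>\<^sup>+s. ?h x s \<partial>lborel)"
    proof (cases "x > 0")
      case True
      then have pos: "1 + k * x > 0" using k by (simp add: add_pos_pos)
      have "(\<integral>\<^sup>+s. ?h x s \<partial>lborel) = (\<integral>\<^sup>+s. ennreal (exp (- (a * x)) / sqrt x) *
          (ennreal (exp (- s * (1 + k * x))) * indicator {0..} s) \<partial>lborel)"
        using True by (intro nn_integral_cong) (simp add: ennreal_mult[symmetric] indicator_def)
      also have "\<dots> = ennreal (exp (- (a * x)) / sqrt x) * ennreal (1 / (1 + k * x))"
        by (subst nn_integral_cmult) (simp_all only: exp_int[OF pos], measurable)
      finally show ?thesis
        using True k by (simp add: ennreal_mult[symmetric])
    qed simp
  qed
  also have "\<dots> = (\<integral>\<^sup>+s. (\<integral>\<^sup>+x. ?h x s \<partial>lborel) \<partial>lborel)"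
    \<comment> \<open>The integrand is nonnegative, so measurability alone justifies the
      exchange.\<close>
    by (rule lborel_pair.Fubini') measurable
  also have "\<dots> = (\<integral>\<^sup>+s. ennreal (sqrt (pi / k)) * (ennreal (exp (- s) / sqrt (s + a / k)) * indicator {0..} s) \<partial>lborel)"
  proof (rule nn_integral_cong)
    fix s :: real
    show "(\<integral>\<^sup>+x. ?h x s \<partial>lborel)
      = ennreal (sqrt (pi / k)) * (ennreal (exp (- s) / sqrt (s + a / k)) * indicator {0..} s)"
    proof (cases "s \<ge> 0")
      case True
      then have pos: "a + s * k > 0" using a k by (simp add: add_pos_nonneg)
      have "(\<integral>\<^sup>+x. ?h x s \<partial>lborel) = (\<integral>\<^sup>+x. ennreal (exp (- s)) *
          (ennreal (exp (- ((a + s * k) * x)) / sqrt x) * indicator {0<..} x) \<partial>lborel)"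
        using True by (intro nn_integral_cong)
          (auto simp: indicator_def ennreal_mult[symmetric] exp_add[symmetric] algebra_simps)
      also have "\<dots> = ennreal (exp (- s)) * ennreal (sqrt (pi / (a + s * k)))"
        by (subst nn_integral_cmult) (simp_all only: nn_integral_exp_over_sqrt[OF pos], measurable)
      also have "pi / (a + s * k) = pi / k / (s + a / k)"
        using k by (simp add: field_simps)
      finally show ?thesis
        using True a k by (simp add: ennreal_mult[symmetric] real_sqrt_divide real_sqrt_mult mult.commute)
    qed simp
  qed
  also have "\<dots> = ennreal (sqrt (pi / k)) * ennreal (exp (a / k) * sqrt pi * (1 - Q_fun (sqrt (a / k))))"
    using nn_integral_exp_over_sqrt_shift[of "a / k"] a k
    by (subst nn_integral_cmult) auto
  also have "\<dots> = ennreal (pi / sqrt k * exp (a / k) * (1 - Q_fun (sqrt (a / k))))"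
  proof -
    have "sqrt (pi / k) * (exp (a / k) * sqrt pi * (1 - Q_fun (sqrt (a / k))))
        = (sqrt pi * sqrt pi) / sqrt k * exp (a / k) * (1 - Q_fun (sqrt (a / k)))"
      unfolding real_sqrt_divide[of pi]
      by (simp only: times_divide_eq_left times_divide_eq_right ac_simps)
    then show ?thesis
      \<comment> \<open>\<open>ennreal_mult'\<close> asks for a nonnegative first factor only; the
        sign of the factor with \<open>Q_fun\<close> is settled later.\<close>
      using k by (simp add: ennreal_mult'[symmetric])
  qed
  finally show ?thesis .
qed

section \<open>Distribution of the signal-to-interference-plus-noise ratio\<close>

text \<open>Given \<beta> = y, the ratio exceeds x when g exceeds
  \<open>x * (c * y + 1) / d\<close>. Averaging this exponential tail over y gives the Laplace
  transform of the law of \<beta>. Here l and m are rates, that is, reciprocal means.\<close>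

lemma (in prob_space) cdf_secondary_sinr:
  fixes g \<beta> :: "'a \<Rightarrow> real"
  assumes c: "c > 0" and d: "d > 0" and l: "l > 0" and m: "m > 0"
    and g: "distributed M lborel g (exponential_density l)"
    and \<beta>: "distributed M lborel \<beta> (exponential_density m)"
    and ind: "indep_var borel g borel \<beta>"
    and x: "x \<ge> 0"
  shows "cdf (distr M borel (secondary_sinr c d g \<beta>)) x
    = 1 - exp (- (x * l / d)) / (1 + c * l / (d * m) * x)"
proof -
  have [measurable]: "g \<in> borel_measurable M" "\<beta> \<in> borel_measurable M"
    using ind by (auto simp: indep_var_distribution_eq)
  have meas[measurable]: "secondary_sinr c d g \<beta> \<in> borel_measurable M"
    unfolding secondary_sinr_def by measurable
  define k where "k = x * l / d"
  have k: "k \<ge> 0" using x l d by (simp add: k_def)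
  define S where "S = {z :: real \<times> real. x < d * fst z / (c * snd z + 1)}"
  have S: "S \<in> sets (borel \<Otimes>\<^sub>M borel)"
  proof -
    have "Measurable.pred (borel \<Otimes>\<^sub>M borel) (\<lambda>z :: real \<times> real. x < d * fst z / (c * snd z + 1))"
      by measurable
    then show ?thesis
      by (simp add: S_def pred_def space_pair_measure)
  qed
  interpret G: prob_space "distr M borel g" by (rule prob_space_distr) simp
  interpret B: prob_space "distr M borel \<beta>" by (rule prob_space_distr) simp
  interpret GB: pair_prob_space "distr M borel g" "distr M borel \<beta>" ..
  have dens: "distr M borel \<beta> = density lborel (exponential_density m)"
    using distributed_distr_eq_density[OF \<beta>] by (simp cong: distr_cong)
  \<comment> \<open>For y >= 0 the denominator is positive and the slice of \<open>S\<close> is a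
    half-line. Negative y are harmless later because the density of \<beta> vanishes there.\<close>
  have tail: "emeasure (distr M borel g) ((\<lambda>u. (u, y)) -` S) = ennreal (exp (- k * (1 + c * y)))"
    if y: "y \<ge> 0" for y
  proof -
    have pos: "c * y + 1 > 0" using c y by (simp add: add_nonneg_pos)
    have "(\<lambda>u. (u, y)) -` S = {x * (c * y + 1) / d<..}"
      using pos d by (auto simp: S_def field_simps)
    then have "emeasure (distr M borel g) ((\<lambda>u. (u, y)) -` S)
        = ennreal (prob {\<omega> \<in> space M. x * (c * y + 1) / d < g \<omega>})"
      by (auto simp: emeasure_distr emeasure_eq_measure vimage_def Int_def conj_commute)
    also have "\<dots> = ennreal (exp (- (x * (c * y + 1) / d) * l))"
      using x pos d by (subst exponential_distributedD_gt[OF g _ l]) auto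
    finally show ?thesis by (simp add: k_def algebra_simps)
  qed
  have pos: "m + k * c > 0" using m k c by (simp add: add_pos_nonneg)
  interpret E: prob_space "density lborel (exponential_density (m + k * c))"
    by (rule prob_space_exponential_density[OF pos])
  have total: "(\<integral>\<^sup>+y. ennreal (exponential_density (m + k * c) y) \<partial>lborel) = 1"
    using E.emeasure_space_1 by (simp add: emeasure_density)
  have "emeasure M {\<omega> \<in> space M. x < secondary_sinr c d g \<beta> \<omega>}
      = emeasure (distr M (borel \<Otimes>\<^sub>M borel) (\<lambda>\<omega>. (g \<omega>, \<beta> \<omega>))) S"
    using S by (subst emeasure_distr)
      (auto simp: S_def secondary_sinr_def intro!: arg_cong[where f = "emeasure M"])
  also have "distr M (borel \<Otimes>\<^sub>M borel) (\<lambda>\<omega>. (g \<omega>, \<beta> \<omega>)) = distr M borel g \<Otimes>\<^sub>M distr M borel \<beta>"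
    using ind by (simp add: indep_var_distribution_eq)
  also have "emeasure \<dots> S = (\<integral>\<^sup>+y. emeasure (distr M borel g) ((\<lambda>u. (u, y)) -` S) \<partial>distr M borel \<beta>)"
    by (rule GB.emeasure_pair_measure_alt2) (use S in simp)
  also have "\<dots> = (\<integral>\<^sup>+y. exponential_density m y * emeasure (distr M borel g) ((\<lambda>u. (u, y)) -` S) \<partial>lborel)"
    unfolding dens by (rule nn_integral_density) (use S in measurable)
  \<comment> \<open>Tilting the density of rate m by the tail gives a multiple of the density of
    rate \<open>m + k * c\<close>, whose total mass is 1, so the integral is read off.\<close>
  also have "\<dots> = (\<integral>\<^sup>+y. ennreal (exp (- k) * m / (m + k * c)) * ennreal (exponential_density (m + k * c) y) \<partial>lborel)"
  proof (rule nn_integral_cong)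
    fix y :: real
    show "exponential_density m y * emeasure (distr M borel g) ((\<lambda>u. (u, y)) -` S)
      = ennreal (exp (- k) * m / (m + k * c)) * ennreal (exponential_density (m + k * c) y)"
    proof (cases "y < 0")
      case False
      have "exp (- y * m) * exp (- k * (1 + c * y)) = exp (- k) * exp (- y * (m + k * c))"
        by (simp add: exp_add[symmetric] algebra_simps)
      then show ?thesis
        using False m pos by (simp add: exponential_density_def tail ennreal_mult[symmetric])
    qed (simp add: exponential_density_def)
  qed
  also have "\<dots> = ennreal (exp (- k) * m / (m + k * c))"
    by (subst nn_integral_cmult) (simp_all add: total)
  finally have gt: "prob {\<omega> \<in> space M. x < secondary_sinr c d g \<beta> \<omega>} = exp (- k) * m / (m + k * c)"
    using m pos by (simp add: emeasure_eq_measure)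
  have "cdf (distr M borel (secondary_sinr c d g \<beta>)) x
      = prob (space M - {\<omega> \<in> space M. x < secondary_sinr c d g \<beta> \<omega>})"
    unfolding cdf_def by (auto simp: measure_distr not_less intro!: arg_cong[where f = prob])
  also have "\<dots> = 1 - exp (- k) * m / (m + k * c)"
    by (subst prob_compl) (simp_all add: gt)
  also have "\<dots> = 1 - exp (- (x * l / d)) / (1 + c * l / (d * m) * x)"
    using m d pos by (simp add: k_def field_simps)
  finally show ?thesis .
qed

section \<open>Evaluation of the symbol error probability\<close>

text \<open>The two terms of F are integrable separately against the weight: the constant 1 yields
  \<open>\<epsilon> / 2\<close>, the other the term with \<open>Q_fun\<close>.\<close>

lemma symbol_error_prob_closed_form:
  fixes k r \<eta> \<epsilon> :: real
  assumes k: "k > 0" and r: "r \<ge> 0" and \<eta>: "\<eta> > 0"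
    and F: "\<And>x. x > 0 \<Longrightarrow> F x = 1 - exp (- (r * x)) / (1 + k * x)"
  shows "symbol_error_prob \<epsilon> \<eta> F = \<epsilon> / 2 - \<epsilon> / 2 * sqrt (\<eta> * pi / k) * exp ((r + \<eta>) / k) *
        (1 - Q_fun (sqrt ((r + \<eta>) / k)))"
proof -
  let ?R = "pi / sqrt k * exp ((r + \<eta>) / k) * (1 - Q_fun (sqrt ((r + \<eta>) / k)))"
  have a: "r + \<eta> > 0" using r \<eta> by simp
  have mono: "mono Q_fun"
    by (rule mono_onI) (auto intro: DERIV_nonneg_imp_nondecreasing[OF _ exI] DERIV_Q_fun)
  \<comment> \<open>An increasing function never exceeds its limit. This gives nonnegativity of
    \<open>?R\<close>, required to turn the \<open>ennreal\<close> value into a Bochner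
    integral.\<close>
  have "Q_fun z \<le> 1" for z
    by (rule tendsto_lowerbound[OF tendsto_Q_fun_at_top])
      (auto intro: eventually_mono[OF eventually_ge_at_top[of z]] monoD[OF mono])
  then have R: "?R \<ge> 0" using k by simp
  have 1: "has_bochner_integral lborel (\<lambda>x. indicator {0<..} x *\<^sub>R (exp (- (\<eta> * x)) / sqrt x)) (sqrt (pi / \<eta>))"
  proof (rule has_bochner_integral_nn_integral)
    show "(\<integral>\<^sup>+x. ennreal (indicator {0<..} x *\<^sub>R (exp (- (\<eta> * x)) / sqrt x)) \<partial>lborel) = ennreal (sqrt (pi / \<eta>))"
      unfolding nn_integral_exp_over_sqrt[OF \<eta>, symmetric]
      by (rule nn_integral_cong) (simp add: indicator_def)
  qed (use \<eta> in \<open>auto simp: indicator_def\<close>)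
  have 2: "has_bochner_integral lborel
      (\<lambda>x. indicator {0<..} x *\<^sub>R (exp (- ((r + \<eta>) * x)) / (sqrt x * (1 + k * x)))) ?R"
  proof (rule has_bochner_integral_nn_integral)
    show "(\<integral>\<^sup>+x. ennreal (indicator {0<..} x *\<^sub>R (exp (- ((r + \<eta>) * x)) / (sqrt x * (1 + k * x)))) \<partial>lborel) = ennreal ?R"
      unfolding nn_integral_exp_over_sqrt_linear[OF a k, symmetric]
      by (rule nn_integral_cong) (simp add: indicator_def)
  qed (use k R in \<open>auto simp: indicator_def\<close>)
  have "(LBINT x:{0<..}. F x * (exp (- (\<eta> * x)) / sqrt x)) = sqrt (pi / \<eta>) - ?R"
  proof -
    have "(LBINT x:{0<..}. F x * (exp (- (\<eta> * x)) / sqrt x))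
      = (\<integral>x. indicator {0<..} x *\<^sub>R (exp (- (\<eta> * x)) / sqrt x)
          - indicator {0<..} x *\<^sub>R (exp (- ((r + \<eta>) * x)) / (sqrt x * (1 + k * x))) \<partial>lborel)"
      unfolding set_lebesgue_integral_def
    proof (rule Bochner_Integration.integral_cong)
      fix x :: real
      have "exp (- ((r + \<eta>) * x)) = exp (- (r * x)) * exp (- (\<eta> * x))"
        by (simp add: exp_add[symmetric] algebra_simps)
      then show "indicator {0<..} x *\<^sub>R (F x * (exp (- (\<eta> * x)) / sqrt x))
        = indicator {0<..} x *\<^sub>R (exp (- (\<eta> * x)) / sqrt x)
          - indicator {0<..} x *\<^sub>R (exp (- ((r + \<eta>) * x)) / (sqrt x * (1 + k * x)))"
        by (cases "x > 0") (simp_all add: F right_diff_distrib diff_divide_distrib mult.commute)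
    qed simp
    also have "\<dots> = sqrt (pi / \<eta>) - ?R"
      using has_bochner_integral_diff[OF 1 2] by (rule has_bochner_integral_integral_eq)
    finally show ?thesis .
  qed
  then have "symbol_error_prob \<epsilon> \<eta> F = \<epsilon> * sqrt \<eta> / (2 * sqrt pi) * (sqrt (pi / \<eta>) - ?R)"
    by (simp add: symbol_error_prob_def)
  also have "\<dots> = \<epsilon> * sqrt \<eta> / (2 * sqrt pi) * sqrt (pi / \<eta>) - \<epsilon> * sqrt \<eta> / (2 * sqrt pi) * ?R"
    by (rule right_diff_distrib)
  also have "\<epsilon> * sqrt \<eta> / (2 * sqrt pi) * sqrt (pi / \<eta>) = \<epsilon> / 2"
    using \<eta> by (simp add: real_sqrt_divide)
  also have "\<epsilon> * sqrt \<eta> / (2 * sqrt pi) * ?R = \<epsilon> / 2 * (sqrt \<eta> * (pi / sqrt pi) / sqrt k) * exp ((r + \<eta>) / k) *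
        (1 - Q_fun (sqrt ((r + \<eta>) / k)))"
    by simp
  also have "sqrt \<eta> * (pi / sqrt pi) / sqrt k = sqrt (\<eta> * pi / k)"
    by (simp add: real_div_sqrt real_sqrt_divide real_sqrt_mult)
  finally show ?thesis .
qed

theorem mainTheorem2:
  fixes M :: "'a measure"
    and g \<beta> :: "'a \<Rightarrow> real"
    and P\<^sub>p N\<^sub>0 B r\<^sub>p P\<^sub>p\<^sub>k \<theta>\<^sub>t\<^sub>h :: real
    and \<Omega>\<^sub>g \<Omega>\<^sub>\<beta> \<Omega>\<^sub>h \<Omega>\<^sub>\<alpha> :: real
    and \<epsilon> \<eta> \<P> c d F\<^sub>0 G\<^sub>0 F\<^sub>1 :: real
  assumes "prob_space M"
    and "P\<^sub>p > 0" "N\<^sub>0 > 0" "B > 0" "r\<^sub>p > 0" "P\<^sub>p\<^sub>k > 0"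
    and "0 < \<theta>\<^sub>t\<^sub>h" "\<theta>\<^sub>t\<^sub>h < 1"
    and "\<Omega>\<^sub>g > 0" "\<Omega>\<^sub>\<beta> > 0" "\<Omega>\<^sub>h > 0" "\<Omega>\<^sub>\<alpha> > 0"
    and "distributed M lborel g (exponential_density (1 / \<Omega>\<^sub>g))"
    and "distributed M lborel \<beta> (exponential_density (1 / \<Omega>\<^sub>\<beta>))"
    and "prob_space.indep_var M borel g borel \<beta>"
    and "\<P> = secondary_power P\<^sub>p N\<^sub>0 B r\<^sub>p P\<^sub>p\<^sub>k \<theta>\<^sub>t\<^sub>h \<Omega>\<^sub>h \<Omega>\<^sub>\<alpha>"
    and "\<P> > 0"
    and "\<epsilon> > 0" "\<eta> > 0"
    and "c = P\<^sub>p / N\<^sub>0"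
    and "d = \<P> / N\<^sub>0"
    and "F\<^sub>0 = c * \<Omega>\<^sub>\<beta> / (d * \<Omega>\<^sub>g)"
    and "1 / G\<^sub>0 = 1 / (d * \<Omega>\<^sub>g)"
    and "1 / F\<^sub>1 = 1 / G\<^sub>0 + \<eta>"
  shows "symbol_error_prob \<epsilon> \<eta> (cdf (distr M borel (secondary_sinr c d g \<beta>))) =
      \<epsilon> / 2 - \<epsilon> / 2 * sqrt (\<eta> * pi / F\<^sub>0) * exp (1 / (F\<^sub>0 * F\<^sub>1)) *
        (1 - Q_fun (1 / sqrt (F\<^sub>0 * F\<^sub>1)))"
proof -
  interpret prob_space M by fact
  have d: "d > 0" and c: "c > 0"
    using assms by auto
  have F\<^sub>0: "F\<^sub>0 > 0" and r: "1 / (d * \<Omega>\<^sub>g) \<ge> 0"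
    using c d assms by auto
  have "symbol_error_prob \<epsilon> \<eta> (cdf (distr M borel (secondary_sinr c d g \<beta>))) =
      \<epsilon> / 2 - \<epsilon> / 2 * sqrt (\<eta> * pi / F\<^sub>0) * exp ((1 / (d * \<Omega>\<^sub>g) + \<eta>) / F\<^sub>0) *
        (1 - Q_fun (sqrt ((1 / (d * \<Omega>\<^sub>g) + \<eta>) / F\<^sub>0)))"
  proof (rule symbol_error_prob_closed_form[OF F\<^sub>0 r \<open>\<eta> > 0\<close>])
    fix x :: real assume "x > 0"
    then show "cdf (distr M borel (secondary_sinr c d g \<beta>)) x
        = 1 - exp (- (1 / (d * \<Omega>\<^sub>g) * x)) / (1 + F\<^sub>0 * x)"
      using cdf_secondary_sinr[of c d "1 / \<Omega>\<^sub>g" "1 / \<Omega>\<^sub>\<beta>" g \<beta> x] c d assms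
      by (simp add: mult.commute)
  qed
  \<comment> \<open>The reciprocal equations are folded from right to left: first into
    \<open>1 / G\<^sub>0\<close>, then into \<open>1 / F\<^sub>1\<close>.\<close>
  moreover have "(1 / (d * \<Omega>\<^sub>g) + \<eta>) / F\<^sub>0 = 1 / (F\<^sub>0 * F\<^sub>1)"
    unfolding assms(23,24)[symmetric] by (simp add: mult.commute)
  ultimately show ?thesis
    by (simp add: real_sqrt_divide)
qed

end
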